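(* The three intervals $[\mathsf{LP}\cap\mathsf{ECQ},\mathsf{LP}]$, $[\mathsf{ECQ},\mathsf{LP}\vee\mathsf{ECQ}]$ and $[\mathsf{ETL},\mathsf{CL}]$ are pairwise disjoint, and every non-trivial proper extension of $\mathsf{BD}$ lies in one of them.
   Context: Formulas are built from a countably infinite set of propositional variables using binary $\wedge,\vee$, unary ${\sim}$ (De Morgan negation) and constants $\top,\bot$. A logic is a set of rules $\Gamma\vdash\varphi$ ($\Gamma$ a set of formulas) closed under reflexivity, monotonicity, cut and substitution. $L_1\le L_2$ means $L_1\subseteq L_2$; an extension of $L$ is a logic containing $L$; the extension of $L$ by a set of rules is the least logic containing both; $L_1\vee L_2$ is the least logic containing $L_1\cup L_2$; the trivial logic contains all rules; $[L_1,L_2]$ is the set of logics $L$ with $L_1\le L\le L_2$. A matrix $\langle A,F\rangle$ is an algebra of this signature with $F\subseteq A$; a rule $\Gamma\vdash\varphi$ is valid in it if every valuation (homomorphism from formulas into $A$) sending $\Gamma$ into $F$ sends $\varphi$ into $F$; $\mathrm{Log}\,\mathbf A$ is the set of rules valid in $\mathbf A$. Let $\mathbf{DM}_4$ be the De Morgan algebra on $\{\bot,n,b,\top\}$ with $\bot<n,b<\top$ ($n,b$ incomparable), ${\sim}\top=\bot$, ${\sim}\bot=\top$, ${\sim}n=n$, ${\sim}b=b$. Let $\mathbf{BD}_4=\langle\mathbf{DM}_4,\{b,\top\}\rangle$, $\mathbf{ETL}_4=\langle\mathbf{DM}_4,\{\top\}\rangle$, $\mathbf{LP}_3$ the submatrix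 of $\mathbf{BD}_4$ on $\{\bot,b,\top\}$ (designated $\{b,\top\}$), $\mathbf{B}_2$ the submatrix of $\mathbf{ETL}_4$ on $\{\bot,\top\}$ (designated $\{\top\}$). $\mathsf{BD}=\mathrm{Log}\,\mathbf{BD}_4$, $\mathsf{ETL}=\mathrm{Log}\,\mathbf{ETL}_4$, $\mathsf{LP}=\mathrm{Log}\,\mathbf{LP}_3$, $\mathsf{CL}=\mathrm{Log}\,\mathbf{B}_2$. $\mathsf{ECQ}$ is the extension of $\mathsf{BD}$ by the rule $p,{\sim}p\vdash q$ ($p,q$ distinct variables). *)

theory Defs
  imports Main
begin

datatype fm =
    Var nat
  | Conj fm fm
  | Disj fm fm
  | Neg fm
  | Top
  | Bot

primrec subst :: "(nat \<Rightarrow> fm) \<Rightarrow> fm \<Rightarrow> fm" where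
  "subst \<sigma> (Var i) = \<sigma> i"
| "subst \<sigma> (Conj \<phi> \<psi>) = Conj (subst \<sigma> \<phi>) (subst \<sigma> \<psi>)"
| "subst \<sigma> (Disj \<phi> \<psi>) = Disj (subst \<sigma> \<phi>) (subst \<sigma> \<psi>)"
| "subst \<sigma> (Neg \<phi>) = Neg (subst \<sigma> \<phi>)"
| "subst \<sigma> Top = Top"
| "subst \<sigma> Bot = Bot"

text \<open>The pair \<open>(\<Gamma>, \<phi>)\<close> is the rule \<open>\<Gamma> \<turnstile> \<phi>\<close>; the premise set \<open>\<Gamma>\<close> may be infinite.\<close>

type_synonym rule = "fm set \<times> fm"

definition is_logic :: "rule set \<Rightarrow> bool" where
  "is_logic L \<longleftrightarrow>
     (\<forall>\<Gamma> \<phi>. \<phi> \<in> \<Gamma> \<longrightarrow> (\<Gamma>, \<phi>) \<in> L) \<and>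
     (\<forall>\<Gamma> \<Delta> \<phi>. (\<Gamma>, \<phi>) \<in> L \<and> \<Gamma> \<subseteq> \<Delta> \<longrightarrow> (\<Delta>, \<phi>) \<in> L) \<and>
     (\<forall>\<Gamma> \<Delta> \<phi>. (\<forall>\<psi>\<in>\<Delta>. (\<Gamma>, \<psi>) \<in> L) \<and> (\<Gamma> \<union> \<Delta>, \<phi>) \<in> L \<longrightarrow> (\<Gamma>, \<phi>) \<in> L) \<and>
     (\<forall>\<Gamma> \<phi> \<sigma>. (\<Gamma>, \<phi>) \<in> L \<longrightarrow> (subst \<sigma> ` \<Gamma>, subst \<sigma> \<phi>) \<in> L)"

definition least_logic :: "rule set \<Rightarrow> rule set" where
  "least_logic R = \<Inter> {L. is_logic L \<and> R \<subseteq> L}"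

definition is_extension :: "rule set \<Rightarrow> rule set \<Rightarrow> bool" where
  "is_extension L L' \<longleftrightarrow> is_logic L' \<and> L \<subseteq> L'"

definition extension_by :: "rule set \<Rightarrow> rule set \<Rightarrow> rule set" where
  "extension_by L R = least_logic (L \<union> R)"

definition logic_join :: "rule set \<Rightarrow> rule set \<Rightarrow> rule set" where
  "logic_join L1 L2 = least_logic (L1 \<union> L2)"

definition logic_interval :: "rule set \<Rightarrow> rule set \<Rightarrow> rule set set" where
  "logic_interval L1 L2 = {L. is_logic L \<and> L1 \<subseteq> L \<and> L \<subseteq> L2}"

definition trivial_logic :: "rule set" where
  "trivial_logic = UNIV"

record 'a matrix =
  universe :: "'a set"
  meet :: "'a \<Rightarrow> 'a \<Rightarrow> 'a"
  join :: "'a \<Rightarrow> 'a \<Rightarrow> 'a"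
  neg :: "'a \<Rightarrow> 'a"
  tt :: 'a
  ff :: 'a
  designated :: "'a set"

definition is_valuation :: "'a matrix \<Rightarrow> (fm \<Rightarrow> 'a) \<Rightarrow> bool" where
  "is_valuation A h \<longleftrightarrow>
     (\<forall>\<phi>. h \<phi> \<in> universe A) \<and>
     (\<forall>\<phi> \<psi>. h (Conj \<phi> \<psi>) = meet A (h \<phi>) (h \<psi>)) \<and>
     (\<forall>\<phi> \<psi>. h (Disj \<phi> \<psi>) = join A (h \<phi>) (h \<psi>)) \<and>
     (\<forall>\<phi>. h (Neg \<phi>) = neg A (h \<phi>)) \<and>
     h Top = tt A \<and>
     h Bot = ff A"

definition valid_in :: "'a matrix \<Rightarrow> rule \<Rightarrow> bool" where
  "valid_in A r \<longleftrightarrow>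
     (\<forall>h. is_valuation A h \<longrightarrow> h ` fst r \<subseteq> designated A \<longrightarrow> h (snd r) \<in> designated A)"

definition Log :: "'a matrix \<Rightarrow> rule set" where
  "Log A = {r. valid_in A r}"

text \<open>Meaningful only if \<open>S\<close> is closed under the operations of \<open>A\<close>.\<close>

definition submatrix :: "'a matrix \<Rightarrow> 'a set \<Rightarrow> 'a matrix" where
  "submatrix A S = A\<lparr>universe := S, designated := designated A \<inter> S\<rparr>"

datatype dm4 = DBot | DN | DB | DTop

instantiation dm4 :: "{distrib_lattice, bounded_lattice}"
begin

definition "bot = DBot"
definition "top = DTop"
definition "x \<le> y \<longleftrightarrow> x = DBot \<or> x = y \<or> y = DTop" for x y :: dm4
definition "x < y \<longleftrightarrow> x \<le> y \<and> x \<noteq> y" for x y :: dm4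
definition "inf x y = (if x \<le> y then x else if y \<le> x then y else DBot)" for x y :: dm4
definition "sup x y = (if x \<le> y then y else if y \<le> x then x else DTop)" for x y :: dm4

instance
proof
  fix x y z :: dm4
  note defs = bot_dm4_def top_dm4_def less_eq_dm4_def less_dm4_def inf_dm4_def sup_dm4_def
  show "x < y \<longleftrightarrow> x \<le> y \<and> \<not> y \<le> x" "x \<le> x" "bot \<le> x" "x \<le> top"
    "inf x y \<le> x" "inf x y \<le> y" "x \<le> sup x y" "y \<le> sup x y"
    by (cases x; cases y; simp add: defs)+
  show "x \<le> y \<Longrightarrow> y \<le> x \<Longrightarrow> x = y"
    by (cases x; cases y; simp add: defs)
  show "x \<le> y \<Longrightarrow> y \<le> z \<Longrightarrow> x \<le> z"
    "x \<le> y \<Longrightarrow> x \<le> z \<Longrightarrow> x \<le> inf y z"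
    "y \<le> x \<Longrightarrow> z \<le> x \<Longrightarrow> sup y z \<le> x"
    "sup x (inf y z) = inf (sup x y) (sup x z)"
    by (cases x; cases y; cases z; simp add: defs)+
qed

end

primrec dm4_neg :: "dm4 \<Rightarrow> dm4" where
  "dm4_neg DBot = DTop"
| "dm4_neg DN = DN"
| "dm4_neg DB = DB"
| "dm4_neg DTop = DBot"

definition DM4_matrix :: "dm4 set \<Rightarrow> dm4 matrix" where
  "DM4_matrix F =
     \<lparr>universe = UNIV, meet = inf, join = sup, neg = dm4_neg, tt = DTop, ff = DBot,
      designated = F\<rparr>"

definition BD4 :: "dm4 matrix" where
  "BD4 = DM4_matrix {DB, DTop}"

definition ETL4 :: "dm4 matrix" where
  "ETL4 = DM4_matrix {DTop}"

definition LP3 :: "dm4 matrix" where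
  "LP3 = submatrix BD4 {DBot, DB, DTop}"

definition B2 :: "dm4 matrix" where
  "B2 = submatrix ETL4 {DBot, DTop}"

definition BD :: "rule set" where
  "BD = Log BD4"

definition ETL :: "rule set" where
  "ETL = Log ETL4"

definition LP :: "rule set" where
  "LP = Log LP3"

definition CL :: "rule set" where
  "CL = Log B2"

definition ECQ :: "rule set" where
  "ECQ = extension_by BD {({Var 0, Neg (Var 0)}, Var 1)}"

end

theory Submission
  imports Defs "HOL-Analysis.Function_Topology"
begin

text \<open>
  Let a rule of an extension \<open>L\<close> of \<open>BD\<close> be refuted by a valuation. Substituting constants and
  formulas in one or two variables for the variables, according to their values in the refuting
  valuation, turns the rule into a fixed one. A refutation in \<open>BD4\<close> gives \<open>p, \<sim>p \<turnstile> q \<or> \<sim>q\<close>, which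
  axiomatizes \<open>LP \<inter> ECQ\<close>; a refutation in \<open>LP3\<close> gives \<open>p, \<sim>p \<turnstile> q\<close>; a refutation in \<open>LP3\<close> of a rule
  whose premises are classically satisfiable gives \<open>p, \<sim>p \<or> q \<turnstile> q\<close>, which axiomatizes \<open>ETL\<close>; and a
  refutation in \<open>B2\<close> makes \<open>L\<close> trivial. That the substituted premises follow in \<open>BD\<close> is seen from
  the monotonicity of all operations in the information order, where \<open>n\<close> is least and \<open>b\<close> is
  greatest. \<open>ECQ\<close> and \<open>LP \<or> ECQ\<close> add to \<open>BD\<close> and \<open>LP\<close> exactly the rules whose premises yield some
  \<open>\<psi>\<close> and \<open>\<sim>\<psi>\<close>, and by compactness a classically unsatisfiable set yields such a pair in \<open>LP\<close>.
\<close>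

section \<open>Logics\<close>

lemma is_logicI:
  assumes "\<And>\<Gamma> \<phi>. \<phi> \<in> \<Gamma> \<Longrightarrow> (\<Gamma>, \<phi>) \<in> L"
    and "\<And>\<Gamma> \<Delta> \<phi>. (\<Gamma>, \<phi>) \<in> L \<Longrightarrow> \<Gamma> \<subseteq> \<Delta> \<Longrightarrow> (\<Delta>, \<phi>) \<in> L"
    and "\<And>\<Gamma> \<Delta> \<phi>. \<forall>\<psi>\<in>\<Delta>. (\<Gamma>, \<psi>) \<in> L \<Longrightarrow> (\<Gamma> \<union> \<Delta>, \<phi>) \<in> L \<Longrightarrow> (\<Gamma>, \<phi>) \<in> L"
    and "\<And>\<Gamma> \<phi> \<sigma>. (\<Gamma>, \<phi>) \<in> L \<Longrightarrow> (subst \<sigma> ` \<Gamma>, subst \<sigma> \<phi>) \<in> L"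
  shows "is_logic L"
  unfolding is_logic_def by (safe; rule assms)

lemma logic_refl: "is_logic L \<Longrightarrow> \<phi> \<in> \<Gamma> \<Longrightarrow> (\<Gamma>, \<phi>) \<in> L"
  by (simp add: is_logic_def)

lemma logic_mono: "is_logic L \<Longrightarrow> (\<Gamma>, \<phi>) \<in> L \<Longrightarrow> \<Gamma> \<subseteq> \<Delta> \<Longrightarrow> (\<Delta>, \<phi>) \<in> L"
  unfolding is_logic_def by (elim conjE, meson)

lemma logic_cut_Un:
  "is_logic L \<Longrightarrow> \<forall>\<psi>\<in>\<Delta>. (\<Gamma>, \<psi>) \<in> L \<Longrightarrow> (\<Gamma> \<union> \<Delta>, \<phi>) \<in> L \<Longrightarrow> (\<Gamma>, \<phi>) \<in> L"
  unfolding is_logic_def by (elim conjE, meson)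

lemma logic_subst: "is_logic L \<Longrightarrow> (\<Gamma>, \<phi>) \<in> L \<Longrightarrow> (subst \<sigma> ` \<Gamma>, subst \<sigma> \<phi>) \<in> L"
  unfolding is_logic_def by (elim conjE, meson)

lemma logic_cut:
  assumes "is_logic L" "\<And>\<psi>. \<psi> \<in> \<Delta> \<Longrightarrow> (\<Gamma>, \<psi>) \<in> L" "(\<Delta>, \<phi>) \<in> L"
  shows "(\<Gamma>, \<phi>) \<in> L"
proof (rule logic_cut_Un[OF assms(1)])
  show "(\<Gamma> \<union> \<Delta>, \<phi>) \<in> L"
    by (rule logic_mono[OF assms(1,3)]) simp
qed (use assms(2) in blast)

lemma is_logic_Inter:
  assumes "\<And>L. L \<in> \<L> \<Longrightarrow> is_logic L"
  shows "is_logic (\<Inter>\<L>)"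
proof (rule is_logicI)
  show "(\<Gamma>, \<phi>) \<in> \<Inter>\<L>" if "\<phi> \<in> \<Gamma>" for \<Gamma> \<phi>
    using that assms logic_refl by blast
  show "(\<Delta>, \<phi>) \<in> \<Inter>\<L>" if "(\<Gamma>, \<phi>) \<in> \<Inter>\<L>" "\<Gamma> \<subseteq> \<Delta>" for \<Gamma> \<Delta> \<phi>
    using that assms logic_mono by blast
  show "(\<Gamma>, \<phi>) \<in> \<Inter>\<L>" if "\<forall>\<psi>\<in>\<Delta>. (\<Gamma>, \<psi>) \<in> \<Inter>\<L>" "(\<Gamma> \<union> \<Delta>, \<phi>) \<in> \<Inter>\<L>" for \<Gamma> \<Delta> \<phi>
    using that assms logic_cut_Un[of _ \<Delta> \<Gamma> \<phi>] by blast
  show "(subst \<sigma> ` \<Gamma>, subst \<sigma> \<phi>) \<in> \<Inter>\<L>" if "(\<Gamma>, \<phi>) \<in> \<Inter>\<L>" for \<Gamma> \<phi> \<sigma>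
    using that assms logic_subst by blast
qed

lemma is_logic_least_logic: "is_logic (least_logic R)"
  unfolding least_logic_def by (rule is_logic_Inter) simp

lemma least_logic_upper: "R \<subseteq> least_logic R"
  unfolding least_logic_def by blast

lemma least_logic_least: "is_logic L \<Longrightarrow> R \<subseteq> L \<Longrightarrow> least_logic R \<subseteq> L"
  unfolding least_logic_def by blast

lemma logic_join_extension_by:
  assumes "K \<subseteq> L"
  shows "logic_join L (extension_by K R) = extension_by L R"
  unfolding logic_join_def extension_by_def
proof (rule antisym)
  have upper: "L \<union> R \<subseteq> least_logic (L \<union> R)"
    by (rule least_logic_upper)
  then have "least_logic (K \<union> R) \<subseteq> least_logic (L \<union> R)"
    using assms by (intro least_logic_least is_logic_least_logic) blast
  with upper show "least_logic (L \<union> least_logic (K \<union> R)) \<subseteq> least_logic (L \<union> R)"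
    by (intro least_logic_least is_logic_least_logic) blast
  show "least_logic (L \<union> R) \<subseteq> least_logic (L \<union> least_logic (K \<union> R))"
    using least_logic_upper[of "K \<union> R"] least_logic_upper[of "L \<union> least_logic (K \<union> R)"]
    by (intro least_logic_least is_logic_least_logic) blast
qed

lemma disjoint_logic_intervals:
  "\<not> L3 \<subseteq> L2 \<Longrightarrow> logic_interval L1 L2 \<inter> logic_interval L3 L4 = {}"
  unfolding logic_interval_def by blast

section \<open>Explosion\<close>

abbreviation explosion :: "fm \<Rightarrow> fm \<Rightarrow> rule" where
  "explosion \<phi> \<psi> \<equiv> ({\<phi>, Neg \<phi>}, \<psi>)"

abbreviation disjunctive_syllogism :: "fm \<Rightarrow> fm \<Rightarrow> rule" where
  "disjunctive_syllogism \<phi> \<psi> \<equiv> ({\<phi>, Disj (Neg \<phi>) \<psi>}, \<psi>)"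

abbreviation excluded_middle :: "fm \<Rightarrow> fm" where
  "excluded_middle \<phi> \<equiv> Disj \<phi> (Neg \<phi>)"

definition inconsistent_in :: "rule set \<Rightarrow> fm set \<Rightarrow> bool" where
  "inconsistent_in L \<Gamma> \<longleftrightarrow> (\<exists>\<psi>. (\<Gamma>, \<psi>) \<in> L \<and> (\<Gamma>, Neg \<psi>) \<in> L)"

definition explosive_closure :: "rule set \<Rightarrow> rule set" where
  "explosive_closure L = {(\<Gamma>, \<phi>). (\<Gamma>, \<phi>) \<in> L \<or> inconsistent_in L \<Gamma>}"

lemma mem_explosive_closure_iff:
  "(\<Gamma>, \<phi>) \<in> explosive_closure L \<longleftrightarrow> (\<Gamma>, \<phi>) \<in> L \<or> inconsistent_in L \<Gamma>"
  by (simp add: explosive_closure_def)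

lemma inconsistent_in_mono:
  "is_logic L \<Longrightarrow> inconsistent_in L \<Gamma> \<Longrightarrow> \<Gamma> \<subseteq> \<Delta> \<Longrightarrow> inconsistent_in L \<Delta>"
  unfolding inconsistent_in_def using logic_mono by blast

lemma inconsistent_in_subst:
  "is_logic L \<Longrightarrow> inconsistent_in L \<Gamma> \<Longrightarrow> inconsistent_in L (subst \<sigma> ` \<Gamma>)"
  unfolding inconsistent_in_def using logic_subst subst.simps(4) by metis

lemma is_logic_explosive_closure:
  assumes L: "is_logic L"
  shows "is_logic (explosive_closure L)"
proof (rule is_logicI; unfold mem_explosive_closure_iff)
  show "(\<Gamma>, \<phi>) \<in> L \<or> inconsistent_in L \<Gamma>" if "\<phi> \<in> \<Gamma>" for \<Gamma> \<phi>
    using that logic_refl[OF L] by blast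
  show "(\<Delta>, \<phi>) \<in> L \<or> inconsistent_in L \<Delta>"
    if "(\<Gamma>, \<phi>) \<in> L \<or> inconsistent_in L \<Gamma>" "\<Gamma> \<subseteq> \<Delta>" for \<Gamma> \<Delta> \<phi>
    using that logic_mono[OF L] inconsistent_in_mono[OF L] by blast
  show "(subst \<sigma> ` \<Gamma>, subst \<sigma> \<phi>) \<in> L \<or> inconsistent_in L (subst \<sigma> ` \<Gamma>)"
    if "(\<Gamma>, \<phi>) \<in> L \<or> inconsistent_in L \<Gamma>" for \<Gamma> \<phi> \<sigma>
    using that logic_subst[OF L] inconsistent_in_subst[OF L] by blast
  show "(\<Gamma>, \<phi>) \<in> L \<or> inconsistent_in L \<Gamma>"
    if \<Delta>: "\<forall>\<psi>\<in>\<Delta>. (\<Gamma>, \<psi>) \<in> L \<or> inconsistent_in L \<Gamma>"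
      and \<phi>: "(\<Gamma> \<union> \<Delta>, \<phi>) \<in> L \<or> inconsistent_in L (\<Gamma> \<union> \<Delta>)" for \<Gamma> \<Delta> \<phi>
  proof (cases "inconsistent_in L \<Gamma>")
    case False
    with \<Delta> have "(\<Gamma>, \<chi>) \<in> L" if "(\<Gamma> \<union> \<Delta>, \<chi>) \<in> L" for \<chi>
      using that logic_cut_Un[OF L] by blast
    with \<phi> show ?thesis
      unfolding inconsistent_in_def by blast
  qed simp
qed

lemma explosion_in_explosive_closure: "is_logic L \<Longrightarrow> explosion \<phi> \<psi> \<in> explosive_closure L"
  unfolding mem_explosive_closure_iff inconsistent_in_def using logic_refl by blast

lemma explosive_closure_subset:
  assumes L: "is_logic L" and "K \<subseteq> L" and explosion: "explosion (Var 0) (Var 1) \<in> L"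
  shows "explosive_closure K \<subseteq> L"
proof -
  have "(\<Gamma>, \<phi>) \<in> L" if "(\<Gamma>, \<psi>) \<in> L" "(\<Gamma>, Neg \<psi>) \<in> L" for \<Gamma> \<phi> \<psi>
  proof (rule logic_cut[OF L])
    show "explosion \<psi> \<phi> \<in> L"
      using logic_subst[OF L explosion, of "Var(0 := \<psi>, 1 := \<phi>)"] by simp
  qed (use that in auto)
  with assms(2) show ?thesis
    by (fastforce simp: mem_explosive_closure_iff inconsistent_in_def)
qed

lemma extension_by_explosion:
  assumes "is_logic L"
  shows "extension_by L {explosion (Var 0) (Var 1)} = explosive_closure L"
  unfolding extension_by_def
proof (rule antisym)
  have "L \<subseteq> explosive_closure L"
    by (auto simp: mem_explosive_closure_iff)
  then show "least_logic (L \<union> {explosion (Var 0) (Var 1)}) \<subseteq> explosive_closure L"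
    by (intro least_logic_least is_logic_explosive_closure assms Un_least)
      (simp_all add: explosion_in_explosive_closure assms)
  show "explosive_closure L \<subseteq> least_logic (L \<union> {explosion (Var 0) (Var 1)})"
    by (intro explosive_closure_subset is_logic_least_logic) (use least_logic_upper in blast)+
qed

section \<open>Logics of matrices and their finitarity\<close>

lemma mem_Log_iff:
  "(\<Gamma>, \<phi>) \<in> Log A \<longleftrightarrow>
    (\<forall>h. is_valuation A h \<longrightarrow> (\<forall>\<gamma>\<in>\<Gamma>. h \<gamma> \<in> designated A) \<longrightarrow> h \<phi> \<in> designated A)"
  by (simp add: Log_def valid_in_def image_subset_iff)

lemma is_valuation_subst: "is_valuation A h \<Longrightarrow> is_valuation A (h \<circ> subst \<sigma>)"
  by (simp add: is_valuation_def)

lemma is_logic_Log: "is_logic (Log A)"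
proof (rule is_logicI)
  show "(subst \<sigma> ` \<Gamma>, subst \<sigma> \<phi>) \<in> Log A" if "(\<Gamma>, \<phi>) \<in> Log A" for \<Gamma> \<phi> \<sigma>
    using that is_valuation_subst[of A _ \<sigma>] unfolding mem_Log_iff by fastforce
qed (unfold mem_Log_iff, blast+)

lemma closedin_product_discrete_if_finitely_determined:
  assumes "finite J" "J \<subseteq> I" "C \<subseteq> (\<Pi>\<^sub>E i\<in>I. S i)"
    and determined: "\<And>g h. g \<in> C \<Longrightarrow> h \<in> (\<Pi>\<^sub>E i\<in>I. S i) \<Longrightarrow> (\<And>j. j \<in> J \<Longrightarrow> g j = h j) \<Longrightarrow> h \<in> C"
  shows "closedin (product_topology (\<lambda>i. discrete_topology (S i)) I) C"
proof -
  have "\<exists>U. finite {i \<in> I. U i \<noteq> S i} \<and> (\<forall>i\<in>I. U i \<subseteq> S i) \<and> h \<in> Pi\<^sub>E I U \<and>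
      Pi\<^sub>E I U \<subseteq> (\<Pi>\<^sub>E i\<in>I. S i) - C"
    if h: "h \<in> (\<Pi>\<^sub>E i\<in>I. S i) - C" for h
  proof -
    define U where "U i = (if i \<in> J then {h i} else S i)" for i
    have "finite {i \<in> I. U i \<noteq> S i}"
      by (rule finite_subset[OF _ \<open>finite J\<close>]) (auto simp: U_def)
    moreover have "\<forall>i\<in>I. U i \<subseteq> S i" "h \<in> Pi\<^sub>E I U"
      using h by (auto simp: U_def PiE_iff)
    moreover have "g \<in> (\<Pi>\<^sub>E i\<in>I. S i) - C" if g: "g \<in> Pi\<^sub>E I U" for g
    proof
      show "g \<in> (\<Pi>\<^sub>E i\<in>I. S i)"
        using g \<open>\<forall>i\<in>I. U i \<subseteq> S i\<close> by (auto simp: PiE_iff)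
      have "g j = h j" if "j \<in> J" for j
        using g that \<open>J \<subseteq> I\<close> by (auto simp: U_def PiE_iff split: if_splits)
      then show "g \<notin> C"
        using determined h by blast
    qed
    ultimately show ?thesis
      by blast
  qed
  with assms(3) show ?thesis
    by (simp add: closedin_def openin_product_topology_alt)
qed

definition formula_map_space :: "'a matrix \<Rightarrow> (fm \<Rightarrow> 'a) topology" where
  "formula_map_space A = product_topology (\<lambda>_. discrete_topology (universe A)) UNIV"

lemma topspace_formula_map_space: "topspace (formula_map_space A) = {h. \<forall>\<phi>. h \<phi> \<in> universe A}"
  by (auto simp: formula_map_space_def PiE_iff)

lemma compact_formula_map_space: "finite (universe A) \<Longrightarrow> compact_space (formula_map_space A)"
  by (simp add: formula_map_space_def compact_space_product_topology
      compact_space_discrete_topology)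

lemma continuous_map_formula_value:
  "continuous_map (formula_map_space A) (discrete_topology (universe A)) (\<lambda>h. h \<phi>)"
  unfolding formula_map_space_def by (rule continuous_map_product_projection) simp

lemma closedin_valuations: "closedin (formula_map_space A) {h. is_valuation A h}"
proof -
  define conditions where
    "conditions = (\<lambda>(\<phi>, \<psi>). {h. (\<forall>\<chi>. h \<chi> \<in> universe A) \<and>
     h (Conj \<phi> \<psi>) = meet A (h \<phi>) (h \<psi>) \<and> h (Disj \<phi> \<psi>) = join A (h \<phi>) (h \<psi>) \<and>
     h (Neg \<phi>) = neg A (h \<phi>) \<and> h Top = tt A \<and> h Bot = ff A})"
  have "{h. is_valuation A h} = (\<Inter>p. conditions p)"
    by (auto simp: is_valuation_def conditions_def)
  moreover have "closedin (formula_map_space A) (conditions (\<phi>, \<psi>))" for \<phi> \<psi>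
    unfolding formula_map_space_def
    by (rule closedin_product_discrete_if_finitely_determined
        [where J = "{\<phi>, \<psi>, Conj \<phi> \<psi>, Disj \<phi> \<psi>, Neg \<phi>, Top, Bot}"])
      (auto simp: conditions_def PiE_iff)
  ultimately show ?thesis
    by auto
qed

lemma Log_finitary:
  assumes finite_universe: "finite (universe A)" and rule: "(\<Gamma>, \<phi>) \<in> Log A"
  obtains \<Gamma>0 where "finite \<Gamma>0" "\<Gamma>0 \<subseteq> \<Gamma>" "(\<Gamma>0, \<phi>) \<in> Log A"
proof -
  let ?X = "formula_map_space A"
  define undesignated where
    "undesignated \<psi> = {h \<in> topspace ?X. h \<psi> \<in> universe A - designated A}" for \<psi>
  have "compactin ?X ({h. is_valuation A h} \<inter> undesignated \<phi>)"
    unfolding undesignated_def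
    by (intro closedin_compact_space compact_formula_map_space finite_universe closedin_Int
        closedin_valuations closedin_continuous_map_preimage[OF continuous_map_formula_value]) simp
  moreover have "{h. is_valuation A h} \<inter> undesignated \<phi> \<subseteq> (\<Union>\<gamma>\<in>\<Gamma>. undesignated \<gamma>)"
    using rule by (auto simp: mem_Log_iff undesignated_def topspace_formula_map_space)
  moreover have "openin ?X (undesignated \<psi>)" for \<psi>
    unfolding undesignated_def
    by (rule openin_continuous_map_preimage[OF continuous_map_formula_value]) simp
  ultimately obtain \<F> where "finite \<F>" "\<F> \<subseteq> undesignated ` \<Gamma>"
    and cover: "{h. is_valuation A h} \<inter> undesignated \<phi> \<subseteq> \<Union>\<F>"
    unfolding compactin_def by (metis (no_types, lifting) imageE)
  then obtain \<Gamma>0 where \<Gamma>0: "finite \<Gamma>0" "\<Gamma>0 \<subseteq> \<Gamma>" "\<F> = undesignated ` \<Gamma>0"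
    by (meson finite_subset_image)
  have "h \<in> undesignated \<psi> \<longleftrightarrow> h \<psi> \<notin> designated A" if "is_valuation A h" for h \<psi>
    using that by (simp add: undesignated_def topspace_formula_map_space is_valuation_def)
  with cover have "(\<Gamma>0, \<phi>) \<in> Log A"
    unfolding mem_Log_iff \<Gamma>0(3) by blast
  with \<Gamma>0 that show thesis
    by blast
qed

section \<open>Four-valued semantics\<close>

text \<open>An element of \<open>DM4\<close> is determined by the truth and the falsity it supports, \<open>n\<close> supporting
  neither and \<open>b\<close> both. Stated by these two predicates, facts about the four values become
  propositional.\<close>

definition told_true :: "dm4 \<Rightarrow> bool" where
  "told_true x \<longleftrightarrow> x \<in> {DB, DTop}"

definition told_false :: "dm4 \<Rightarrow> bool" where
  "told_false x \<longleftrightarrow> x \<in> {DB, DBot}"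

lemma told_dm4_values [simp]:
  "\<not> told_true DBot" "\<not> told_true DN" "told_true DB" "told_true DTop"
  "told_false DBot" "\<not> told_false DN" "told_false DB" "\<not> told_false DTop"
  by (simp_all add: told_true_def told_false_def)

lemma told_dm4_neg [simp]:
  "told_true (dm4_neg x) \<longleftrightarrow> told_false x"
  "told_false (dm4_neg x) \<longleftrightarrow> told_true x"
  by (cases x; simp)+

lemma told_inf_sup [simp]:
  "told_true (inf x y) \<longleftrightarrow> told_true x \<and> told_true y"
  "told_false (inf x y) \<longleftrightarrow> told_false x \<or> told_false y"
  "told_true (sup x y) \<longleftrightarrow> told_true x \<or> told_true y"
  "told_false (sup x y) \<longleftrightarrow> told_false x \<and> told_false y"
  by (cases x; cases y; simp add: less_eq_dm4_def inf_dm4_def sup_dm4_def)+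

lemma eq_DTop_iff: "x = DTop \<longleftrightarrow> told_true x \<and> \<not> told_false x"
  by (cases x) simp_all

lemma BD4_designated_eq: "{DB, DTop} = Collect told_true"
  by (auto simp: told_true_def)

lemma LP3_universe_eq: "{DBot, DB, DTop} = {x. told_true x \<or> told_false x}"
  by (auto simp: told_true_def told_false_def)

lemma B2_universe_eq: "{DBot, DTop} = {x. told_true x \<longleftrightarrow> \<not> told_false x}"
proof (rule set_eqI)
  show "x \<in> {DBot, DTop} \<longleftrightarrow> x \<in> {x. told_true x \<longleftrightarrow> \<not> told_false x}" for x
    by (cases x) simp_all
qed

primrec eval :: "(nat \<Rightarrow> dm4) \<Rightarrow> fm \<Rightarrow> dm4" where
  "eval e (Var i) = e i"
| "eval e (Conj \<phi> \<psi>) = inf (eval e \<phi>) (eval e \<psi>)"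
| "eval e (Disj \<phi> \<psi>) = sup (eval e \<phi>) (eval e \<psi>)"
| "eval e (Neg \<phi>) = dm4_neg (eval e \<phi>)"
| "eval e Top = DTop"
| "eval e Bot = DBot"

abbreviation satisfies :: "(nat \<Rightarrow> dm4) \<Rightarrow> fm \<Rightarrow> bool" (infix "\<Turnstile>" 50) where
  "e \<Turnstile> \<phi> \<equiv> told_true (eval e \<phi>)"

abbreviation models :: "(nat \<Rightarrow> dm4) \<Rightarrow> fm set \<Rightarrow> bool" where
  "models e \<Gamma> \<equiv> \<forall>\<gamma>\<in>\<Gamma>. e \<Turnstile> \<gamma>"

lemma eval_subst: "eval e (subst \<sigma> \<phi>) = eval (\<lambda>i. eval e (\<sigma> i)) \<phi>"
  by (induction \<phi>) auto

definition subuniverse :: "dm4 set \<Rightarrow> bool" where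
  "subuniverse S \<longleftrightarrow> DTop \<in> S \<and> DBot \<in> S \<and>
     (\<forall>x\<in>S. dm4_neg x \<in> S \<and> (\<forall>y\<in>S. inf x y \<in> S \<and> sup x y \<in> S))"

lemma subuniverse_UNIV: "subuniverse UNIV"
  by (simp add: subuniverse_def)

lemma subuniverse_LP3: "subuniverse {DBot, DB, DTop}"
  unfolding LP3_universe_eq by (auto simp: subuniverse_def)

lemma subuniverse_B2: "subuniverse {DBot, DTop}"
  unfolding B2_universe_eq by (auto simp: subuniverse_def)

lemma eval_in_subuniverse:
  assumes "subuniverse S" "range e \<subseteq> S"
  shows "eval e \<phi> \<in> S"
  using assms by (induction \<phi>) (auto simp: subuniverse_def)

lemma is_valuation_submatrix_iff:
  assumes "subuniverse S"
  shows "is_valuation (submatrix (DM4_matrix F) S) h \<longleftrightarrow> (\<exists>e. range e \<subseteq> S \<and> h = eval e)"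
proof
  assume h: "is_valuation (submatrix (DM4_matrix F) S) h"
  have "eval (h \<circ> Var) \<phi> = h \<phi>" for \<phi>
    using h by (induction \<phi>) (auto simp: is_valuation_def submatrix_def DM4_matrix_def)
  moreover have "range (h \<circ> Var) \<subseteq> S"
    using h by (auto simp: is_valuation_def submatrix_def DM4_matrix_def)
  ultimately show "\<exists>e. range e \<subseteq> S \<and> h = eval e"
    by (metis ext)
next
  assume "\<exists>e. range e \<subseteq> S \<and> h = eval e"
  then show "is_valuation (submatrix (DM4_matrix F) S) h"
    using eval_in_subuniverse[OF assms]
    by (auto simp: is_valuation_def submatrix_def DM4_matrix_def)
qed

lemma mem_Log_submatrix_iff:
  assumes "subuniverse S"
  shows "(\<Gamma>, \<phi>) \<in> Log (submatrix (DM4_matrix F) S) \<longleftrightarrow>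
    (\<forall>e. range e \<subseteq> S \<longrightarrow> (\<forall>\<gamma>\<in>\<Gamma>. eval e \<gamma> \<in> F) \<longrightarrow> eval e \<phi> \<in> F)"
proof -
  have "designated (submatrix (DM4_matrix F) S) = F \<inter> S"
    by (simp add: submatrix_def DM4_matrix_def)
  then have "(\<Gamma>, \<phi>) \<in> Log (submatrix (DM4_matrix F) S) \<longleftrightarrow>
      (\<forall>e. range e \<subseteq> S \<longrightarrow> (\<forall>\<gamma>\<in>\<Gamma>. eval e \<gamma> \<in> F \<inter> S) \<longrightarrow> eval e \<phi> \<in> F \<inter> S)"
    unfolding mem_Log_iff is_valuation_submatrix_iff[OF assms] by metis
  then show ?thesis
    using eval_in_subuniverse[OF assms] by simp
qed

lemma submatrix_UNIV: "submatrix (DM4_matrix F) UNIV = DM4_matrix F"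
  by (simp add: submatrix_def DM4_matrix_def)

definition gap_free :: "(nat \<Rightarrow> dm4) \<Rightarrow> bool" where
  "gap_free e \<longleftrightarrow> (\<forall>i. told_true (e i) \<or> told_false (e i))"

definition classical :: "(nat \<Rightarrow> dm4) \<Rightarrow> bool" where
  "classical e \<longleftrightarrow> (\<forall>i. told_true (e i) \<longleftrightarrow> \<not> told_false (e i))"

lemma classical_imp_gap_free: "classical e \<Longrightarrow> gap_free e"
  by (auto simp: classical_def gap_free_def)

lemma classical_eval: "classical e \<Longrightarrow> told_true (eval e \<phi>) \<longleftrightarrow> \<not> told_false (eval e \<phi>)"
  by (induction \<phi>) (auto simp: classical_def)

lemma classical_satisfies_Neg: "classical e \<Longrightarrow> e \<Turnstile> Neg \<phi> \<longleftrightarrow> \<not> e \<Turnstile> \<phi>"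
  by (simp add: classical_eval)

lemma mem_BD_iff: "(\<Gamma>, \<phi>) \<in> BD \<longleftrightarrow> (\<forall>e. models e \<Gamma> \<longrightarrow> e \<Turnstile> \<phi>)"
  using mem_Log_submatrix_iff[OF subuniverse_UNIV]
  by (simp add: BD_def BD4_def submatrix_UNIV BD4_designated_eq)

lemma mem_ETL_iff: "(\<Gamma>, \<phi>) \<in> ETL \<longleftrightarrow> (\<forall>e. (\<forall>\<gamma>\<in>\<Gamma>. eval e \<gamma> = DTop) \<longrightarrow> eval e \<phi> = DTop)"
  using mem_Log_submatrix_iff[OF subuniverse_UNIV]
  by (simp add: ETL_def ETL4_def submatrix_UNIV)

lemma mem_LP_iff: "(\<Gamma>, \<phi>) \<in> LP \<longleftrightarrow> (\<forall>e. gap_free e \<longrightarrow> models e \<Gamma> \<longrightarrow> e \<Turnstile> \<phi>)"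
proof -
  have "range e \<subseteq> {DBot, DB, DTop} \<longleftrightarrow> gap_free e" for e
    unfolding LP3_universe_eq by (auto simp: gap_free_def)
  then show ?thesis
    unfolding LP_def LP3_def BD4_def mem_Log_submatrix_iff[OF subuniverse_LP3]
    by (simp add: BD4_designated_eq)
qed

lemma mem_CL_iff: "(\<Gamma>, \<phi>) \<in> CL \<longleftrightarrow> (\<forall>e. classical e \<longrightarrow> models e \<Gamma> \<longrightarrow> e \<Turnstile> \<phi>)"
proof -
  have "range e \<subseteq> {DBot, DTop} \<longleftrightarrow> classical e" for e
    unfolding B2_universe_eq by (auto simp: classical_def)
  moreover have "eval e \<psi> = DTop \<longleftrightarrow> e \<Turnstile> \<psi>" if "classical e" for e \<psi>
    using classical_eval[OF that] by (simp add: eq_DTop_iff)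
  ultimately show ?thesis
    unfolding CL_def B2_def ETL4_def mem_Log_submatrix_iff[OF subuniverse_B2] by simp
qed

lemma is_logic_BD: "is_logic BD" and is_logic_LP: "is_logic LP"
  by (simp_all add: BD_def LP_def is_logic_Log)

lemma BD_subset_LP: "BD \<subseteq> LP"
  by (auto simp: mem_BD_iff mem_LP_iff)

lemma LP_subset_CL: "LP \<subseteq> CL"
  using classical_imp_gap_free by (auto simp: mem_LP_iff mem_CL_iff)

lemma mem_LP_iff_mem_BD_excluded_middles:
  "(\<Gamma>, \<phi>) \<in> LP \<longleftrightarrow> (\<Gamma> \<union> range (\<lambda>i. excluded_middle (Var i)), \<phi>) \<in> BD"
  by (simp add: mem_LP_iff mem_BD_iff gap_free_def ball_Un imp_conjL all_conj_distrib) blast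

definition info_le :: "dm4 \<Rightarrow> dm4 \<Rightarrow> bool" (infix "\<sqsubseteq>" 50) where
  "x \<sqsubseteq> y \<longleftrightarrow> (told_true x \<longrightarrow> told_true y) \<and> (told_false x \<longrightarrow> told_false y)"

lemma eval_info_mono: "\<forall>i. e i \<sqsubseteq> f i \<Longrightarrow> eval e \<phi> \<sqsubseteq> eval f \<phi>"
  by (induction \<phi>) (auto simp: info_le_def)

lemma satisfies_info_mono: "\<forall>i. e i \<sqsubseteq> f i \<Longrightarrow> e \<Turnstile> \<phi> \<Longrightarrow> f \<Turnstile> \<phi>"
  using eval_info_mono unfolding info_le_def by blast

lemma gap_free_obtains_classical:
  assumes "gap_free e"
  obtains f where "classical f" "\<forall>i. f i \<sqsubseteq> e i"
proof
  let ?f = "\<lambda>i. if told_true (e i) then DTop else DBot"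
  show "classical ?f" "\<forall>i. ?f i \<sqsubseteq> e i"
    using assms by (auto simp: classical_def gap_free_def info_le_def)
qed

definition Conjs :: "fm list \<Rightarrow> fm" where
  "Conjs \<phi>s = foldr Conj \<phi>s Top"

lemma told_eval_Conjs [simp]:
  "told_true (eval e (Conjs \<phi>s)) \<longleftrightarrow> models e (set \<phi>s)"
  "told_false (eval e (Conjs \<phi>s)) \<longleftrightarrow> (\<exists>\<phi>\<in>set \<phi>s. told_false (eval e \<phi>))"
  by (induction \<phi>s) (simp_all add: Conjs_def)

lemma ETL_imp_BD_Disj_Neg_Conjs:
  assumes "(set \<phi>s, \<psi>) \<in> ETL"
  shows "(set \<phi>s, Disj (Neg (Conjs \<phi>s)) \<psi>) \<in> BD"
  using assms unfolding mem_BD_iff mem_ETL_iff eq_DTop_iff by auto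

lemma finite_UNIV_dm4: "finite (UNIV :: dm4 set)"
proof (rule finite_subset)
  show "UNIV \<subseteq> {DBot, DN, DB, DTop}"
    using dm4.exhaust by blast
qed simp

lemma Log_finitary_list:
  assumes "finite (universe A)" "(\<Gamma>, \<phi>) \<in> Log A"
  obtains \<gamma>s where "set \<gamma>s \<subseteq> \<Gamma>" "(set \<gamma>s, \<phi>) \<in> Log A"
proof -
  obtain \<Gamma>0 where "finite \<Gamma>0" "\<Gamma>0 \<subseteq> \<Gamma>" "(\<Gamma>0, \<phi>) \<in> Log A"
    using assms by (rule Log_finitary)
  moreover from \<open>finite \<Gamma>0\<close> obtain \<gamma>s where "set \<gamma>s = \<Gamma>0"
    using finite_list by blast
  ultimately show thesis
    using that by blast
qed

lemma finite_universe_ETL4: "finite (universe ETL4)"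
  by (simp add: ETL4_def DM4_matrix_def finite_UNIV_dm4)

lemma finite_universe_B2: "finite (universe B2)"
  by (simp add: B2_def submatrix_def)

section \<open>The logics \<open>ECQ\<close> and \<open>LP \<or> ECQ\<close>\<close>

lemma inconsistent_in_LP_iff: "inconsistent_in LP \<Gamma> \<longleftrightarrow> (\<Gamma>, Bot) \<in> CL"
proof
  assume "inconsistent_in LP \<Gamma>"
  then obtain \<psi> where "(\<Gamma>, \<psi>) \<in> CL" "(\<Gamma>, Neg \<psi>) \<in> CL"
    unfolding inconsistent_in_def using LP_subset_CL by blast
  then show "(\<Gamma>, Bot) \<in> CL"
    using classical_satisfies_Neg by (auto simp: mem_CL_iff)
next
  assume "(\<Gamma>, Bot) \<in> CL"
  then obtain \<gamma>s where \<gamma>s: "set \<gamma>s \<subseteq> \<Gamma>" "(set \<gamma>s, Bot) \<in> CL"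
    unfolding CL_def by (rule Log_finitary_list[OF finite_universe_B2])
  have "(\<Gamma>, Conjs \<gamma>s) \<in> LP"
    using \<gamma>s(1) by (auto simp: mem_LP_iff)
  moreover have "e \<Turnstile> Neg (Conjs \<gamma>s)" if "gap_free e" for e
  proof -
    obtain f where f: "classical f" "\<forall>i. f i \<sqsubseteq> e i"
      using \<open>gap_free e\<close> by (rule gap_free_obtains_classical)
    then have "\<not> f \<Turnstile> Conjs \<gamma>s"
      using \<gamma>s(2) by (auto simp: mem_CL_iff)
    then have "f \<Turnstile> Neg (Conjs \<gamma>s)"
      using classical_satisfies_Neg[OF f(1)] by blast
    then show ?thesis
      by (rule satisfies_info_mono[OF f(2)])
  qed
  then have "(\<Gamma>, Neg (Conjs \<gamma>s)) \<in> LP"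
    by (simp add: mem_LP_iff)
  ultimately show "inconsistent_in LP \<Gamma>"
    unfolding inconsistent_in_def by blast
qed

lemma ECQ_eq_explosive_closure: "ECQ = explosive_closure BD"
  unfolding ECQ_def by (rule extension_by_explosion[OF is_logic_BD])

lemma join_LP_ECQ_eq_explosive_closure: "logic_join LP ECQ = explosive_closure LP"
  unfolding ECQ_def logic_join_extension_by[OF BD_subset_LP]
  by (rule extension_by_explosion[OF is_logic_LP])

lemma mem_join_LP_ECQ_iff: "(\<Gamma>, \<phi>) \<in> logic_join LP ECQ \<longleftrightarrow> (\<Gamma>, \<phi>) \<in> LP \<or> (\<Gamma>, Bot) \<in> CL"
  by (simp add: join_LP_ECQ_eq_explosive_closure mem_explosive_closure_iff inconsistent_in_LP_iff)

lemma LP_subset_join_LP_ECQ: "LP \<subseteq> logic_join LP ECQ"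
  using mem_join_LP_ECQ_iff by auto

lemma ECQ_not_subset_LP: "\<not> ECQ \<subseteq> LP"
proof -
  have "explosion (Var 0) Bot \<in> ECQ"
    unfolding ECQ_eq_explosive_closure by (rule explosion_in_explosive_closure[OF is_logic_BD])
  moreover have "explosion (Var 0) Bot \<notin> LP"
    by (auto simp: mem_LP_iff gap_free_def intro!: exI[of _ "\<lambda>_. DB"])
  ultimately show ?thesis
    by blast
qed

lemma disjunctive_syllogism_in_ETL: "disjunctive_syllogism \<phi> \<psi> \<in> ETL"
  by (auto simp: mem_ETL_iff eq_DTop_iff)

lemma disjunctive_syllogism_notin_join_LP_ECQ:
  "disjunctive_syllogism (Var 0) (Var 1) \<notin> logic_join LP ECQ"
proof -
  have "disjunctive_syllogism (Var 0) (Var 1) \<notin> LP"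
    by (auto simp: mem_LP_iff gap_free_def intro!: exI[of _ "(\<lambda>_. DB)(1 := DBot)"])
  moreover have "({Var 0, Disj (Neg (Var 0)) (Var 1)}, Bot) \<notin> CL"
    by (auto simp: mem_CL_iff classical_def intro!: exI[of _ "\<lambda>_. DTop"])
  ultimately show ?thesis
    by (simp add: mem_join_LP_ECQ_iff)
qed

lemma ETL_not_subset_join_LP_ECQ: "\<not> ETL \<subseteq> logic_join LP ECQ"
  using disjunctive_syllogism_in_ETL disjunctive_syllogism_notin_join_LP_ECQ by blast

section \<open>Extensions of \<open>BD\<close>\<close>

locale BD_extension =
  fixes L :: "rule set"
  assumes is_logic: "is_logic L" and BD_subset: "BD \<subseteq> L"
begin

lemma derivable_by_refuted_rule:
  assumes rule: "(\<Gamma>, \<phi>) \<in> L" and refuted: "\<not> v \<Turnstile> \<phi>"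
    and premises_above: "\<And>e. models e \<Delta> \<Longrightarrow> \<exists>u. models u \<Gamma> \<and> (\<forall>i. u i \<sqsubseteq> eval e (\<sigma> i))"
    and refutation_below: "\<And>e. models e \<Delta> \<Longrightarrow> \<not> e \<Turnstile> \<chi> \<Longrightarrow> \<forall>i. eval e (\<sigma> i) \<sqsubseteq> v i"
  shows "(\<Delta>, \<chi>) \<in> L"
proof -
  have "(\<Delta>, subst \<sigma> \<gamma>) \<in> BD" if "\<gamma> \<in> \<Gamma>" for \<gamma>
    unfolding mem_BD_iff eval_subst using that premises_above satisfies_info_mono by meson
  then have "(\<Delta>, subst \<sigma> \<phi>) \<in> L"
    using logic_cut[OF is_logic _ logic_subst[OF is_logic rule, of \<sigma>]] BD_subset by blast
  then have "(\<Delta>, \<psi>) \<in> L" if "\<psi> \<in> insert (subst \<sigma> \<phi>) \<Delta>" for \<psi>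
    using that logic_refl[OF is_logic] by blast
  moreover have "(insert (subst \<sigma> \<phi>) \<Delta>, \<chi>) \<in> BD"
    unfolding mem_BD_iff
  proof (intro allI impI)
    fix e assume e: "models e (insert (subst \<sigma> \<phi>) \<Delta>)"
    show "e \<Turnstile> \<chi>"
    proof (rule ccontr)
      assume "\<not> e \<Turnstile> \<chi>"
      with e have "\<forall>i. eval e (\<sigma> i) \<sqsubseteq> v i"
        using refutation_below by blast
      with e have "v \<Turnstile> \<phi>"
        using satisfies_info_mono[of "\<lambda>i. eval e (\<sigma> i)" v] by (simp add: eval_subst)
      with refuted show False
        by blast
    qed
  qed
  ultimately show ?thesis
    using logic_cut[OF is_logic] BD_subset by blast
qed

lemma explosion_excluded_middle_if_proper:
  assumes "L \<noteq> BD"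
  shows "explosion (Var 0) (excluded_middle (Var 1)) \<in> L"
proof -
  obtain \<Gamma> \<phi> where rule: "(\<Gamma>, \<phi>) \<in> L" and "(\<Gamma>, \<phi>) \<notin> BD"
    using assms BD_subset by auto
  then obtain v where v: "models v \<Gamma>" "\<not> v \<Turnstile> \<phi>"
    unfolding mem_BD_iff by blast
  define \<sigma> where
    "\<sigma> i = (case v i of DBot \<Rightarrow> Bot | DN \<Rightarrow> Var 1 | DB \<Rightarrow> Var 0 | DTop \<Rightarrow> Top)" for i
  show ?thesis
  proof (rule derivable_by_refuted_rule[OF rule v(2), where \<sigma> = \<sigma>])
    fix e assume e: "models e {Var 0, Neg (Var 0)}"
    then have "v i \<sqsubseteq> eval e (\<sigma> i)" for i
      by (simp add: \<sigma>_def info_le_def split: dm4.split)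
    with v(1) show "\<exists>u. models u \<Gamma> \<and> (\<forall>i. u i \<sqsubseteq> eval e (\<sigma> i))"
      by blast
    assume "\<not> e \<Turnstile> excluded_middle (Var 1)"
    then show "\<forall>i. eval e (\<sigma> i) \<sqsubseteq> v i"
      by (simp add: \<sigma>_def info_le_def split: dm4.split)
  qed
qed

lemma explosion_if_not_subset_LP:
  assumes "\<not> L \<subseteq> LP"
  shows "explosion (Var 0) (Var 1) \<in> L"
proof -
  obtain \<Gamma> \<phi> where rule: "(\<Gamma>, \<phi>) \<in> L" and "(\<Gamma>, \<phi>) \<notin> LP"
    using assms by auto
  then obtain v where v: "gap_free v" "models v \<Gamma>" "\<not> v \<Turnstile> \<phi>"
    unfolding mem_LP_iff by blast
  define \<sigma> where "\<sigma> i = (case v i of DBot \<Rightarrow> Bot | DTop \<Rightarrow> Top | _ \<Rightarrow> Var 0)" for i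
  have \<sigma>: "eval e (\<sigma> i) \<sqsubseteq> v i \<and> v i \<sqsubseteq> eval e (\<sigma> i)" if "models e {Var 0, Neg (Var 0)}" for e i
    using that v(1)[unfolded gap_free_def, rule_format, of i]
    by (cases "v i") (simp_all add: \<sigma>_def info_le_def)
  show ?thesis
    by (rule derivable_by_refuted_rule[OF rule v(3), where \<sigma> = \<sigma>]) (use \<sigma> v(2) in blast)+
qed

lemma disjunctive_syllogism_if_not_subset_join_LP_ECQ:
  assumes "\<not> L \<subseteq> logic_join LP ECQ"
  shows "disjunctive_syllogism (Var 0) (Var 1) \<in> L"
proof -
  obtain \<Gamma> \<phi> where rule: "(\<Gamma>, \<phi>) \<in> L" and "(\<Gamma>, \<phi>) \<notin> LP" "(\<Gamma>, Bot) \<notin> CL"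
    using assms by (auto simp: subset_iff mem_join_LP_ECQ_iff)
  then obtain v u where v: "gap_free v" "models v \<Gamma>" "\<not> v \<Turnstile> \<phi>"
    and u: "classical u" "models u \<Gamma>"
    unfolding mem_LP_iff mem_CL_iff by blast
  \<comment> \<open>Where the premises hold, \<open>\<sigma>\<close> takes the values of \<open>v\<close> if \<open>q\<close> is undesignated (so that
    \<open>p = b\<close>), and values above those of \<open>u\<close> in the information order otherwise.\<close>
  define \<sigma> where "\<sigma> i =
    (case v i of
       DBot \<Rightarrow> if told_true (u i) then Conj (Var 0) (Var 1) else Bot
     | DTop \<Rightarrow> if told_true (u i) then Top else Disj (Neg (Var 0)) (Neg (Var 1))
     | _ \<Rightarrow> if told_true (u i) then Var 0 else Neg (Var 0))" for i
  have v_neq_DN: "v i \<noteq> DN" for i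
    using v(1) unfolding gap_free_def by (metis told_dm4_values)
  have told_false_u: "told_false (u i) \<longleftrightarrow> \<not> told_true (u i)" for i
    using u(1) by (simp add: classical_def)
  let ?premises = "{Var 0, Disj (Neg (Var 0)) (Var 1)}"
  have above_u: "\<forall>i. u i \<sqsubseteq> eval e (\<sigma> i)" if "models e ?premises" "e \<Turnstile> Var 1" for e
    using that v_neq_DN by (auto simp: \<sigma>_def info_le_def told_false_u split: dm4.split)
  have eq_v: "\<forall>i. eval e (\<sigma> i) \<sqsubseteq> v i \<and> v i \<sqsubseteq> eval e (\<sigma> i)"
    if "models e ?premises" "\<not> e \<Turnstile> Var 1" for e
    using that v_neq_DN by (auto simp: \<sigma>_def info_le_def told_false_u split: dm4.split)
  show ?thesis
  proof (rule derivable_by_refuted_rule[OF rule v(3), where \<sigma> = \<sigma>])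
    show "\<exists>w. models w \<Gamma> \<and> (\<forall>i. w i \<sqsubseteq> eval e (\<sigma> i))" if "models e ?premises" for e
      using above_u[OF that] eq_v[OF that] u(2) v(2) by blast
  qed (use eq_v in blast)
qed

lemma derivable_if_not_subset_CL:
  assumes "\<not> L \<subseteq> CL"
  shows "(\<Delta>, \<chi>) \<in> L"
proof -
  obtain \<Gamma> \<phi> where rule: "(\<Gamma>, \<phi>) \<in> L" and "(\<Gamma>, \<phi>) \<notin> CL"
    using assms by auto
  then obtain u where u: "classical u" "models u \<Gamma>" "\<not> u \<Turnstile> \<phi>"
    unfolding mem_CL_iff by blast
  define \<sigma> where "\<sigma> i = (if told_true (u i) then Top else Bot)" for i
  have \<sigma>: "eval e (\<sigma> i) \<sqsubseteq> u i \<and> u i \<sqsubseteq> eval e (\<sigma> i)" for e i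
    using u(1) by (auto simp: \<sigma>_def info_le_def classical_def)
  show ?thesis
    by (rule derivable_by_refuted_rule[OF rule u(3), where \<sigma> = \<sigma>]) (use \<sigma> u(2) in blast)+
qed

lemma LP_Int_ECQ_subset:
  assumes rule: "explosion (Var 0) (excluded_middle (Var 1)) \<in> L"
  shows "LP \<inter> ECQ \<subseteq> L"
proof clarify
  fix \<Gamma> \<phi> assume LP: "(\<Gamma>, \<phi>) \<in> LP" and "(\<Gamma>, \<phi>) \<in> ECQ"
  then consider "(\<Gamma>, \<phi>) \<in> BD" | \<psi> where "(\<Gamma>, \<psi>) \<in> BD" "(\<Gamma>, Neg \<psi>) \<in> BD"
    unfolding ECQ_eq_explosive_closure mem_explosive_closure_iff inconsistent_in_def by blast
  then show "(\<Gamma>, \<phi>) \<in> L"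
  proof cases
    case 1
    with BD_subset show ?thesis
      by blast
  next
    case (2 \<psi>)
    have "(\<Gamma>, excluded_middle (Var i)) \<in> L" for i
    proof (rule logic_cut[OF is_logic])
      show "explosion \<psi> (excluded_middle (Var i)) \<in> L"
        using logic_subst[OF is_logic rule, of "Var(0 := \<psi>, 1 := Var i)"] by simp
    qed (use 2 BD_subset in auto)
    then have "\<forall>\<chi>\<in>range (\<lambda>i. excluded_middle (Var i)). (\<Gamma>, \<chi>) \<in> L"
      by blast
    moreover have "(\<Gamma> \<union> range (\<lambda>i. excluded_middle (Var i)), \<phi>) \<in> L"
      using LP[unfolded mem_LP_iff_mem_BD_excluded_middles] by (rule subsetD[OF BD_subset])
    ultimately show ?thesis
      by (rule logic_cut_Un[OF is_logic])
  qed
qed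

lemma ECQ_subset: "explosion (Var 0) (Var 1) \<in> L \<Longrightarrow> ECQ \<subseteq> L"
  unfolding ECQ_eq_explosive_closure by (rule explosive_closure_subset[OF is_logic BD_subset])

lemma ETL_subset:
  assumes rule: "disjunctive_syllogism (Var 0) (Var 1) \<in> L"
  shows "ETL \<subseteq> L"
proof clarify
  fix \<Gamma> \<phi> assume "(\<Gamma>, \<phi>) \<in> ETL"
  then obtain \<gamma>s where \<gamma>s: "set \<gamma>s \<subseteq> \<Gamma>" "(set \<gamma>s, \<phi>) \<in> ETL"
    unfolding ETL_def by (rule Log_finitary_list[OF finite_universe_ETL4])
  have "(set \<gamma>s, \<phi>) \<in> L"
  proof (rule logic_cut[OF is_logic])
    show "disjunctive_syllogism (Conjs \<gamma>s) \<phi> \<in> L"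
      using logic_subst[OF is_logic rule, of "Var(0 := Conjs \<gamma>s, 1 := \<phi>)"] by simp
    have "(set \<gamma>s, Conjs \<gamma>s) \<in> BD"
      by (simp add: mem_BD_iff)
    then show "(set \<gamma>s, \<psi>) \<in> L" if "\<psi> \<in> {Conjs \<gamma>s, Disj (Neg (Conjs \<gamma>s)) \<phi>}" for \<psi>
      using that ETL_imp_BD_Disj_Neg_Conjs[OF \<gamma>s(2)] BD_subset by blast
  qed
  with \<gamma>s(1) show "(\<Gamma>, \<phi>) \<in> L"
    using logic_mono[OF is_logic] by blast
qed

end

theorem theorem6p9:
  shows "logic_interval (LP \<inter> ECQ) LP \<inter> logic_interval ECQ (logic_join LP ECQ) = {} \<and>
         logic_interval (LP \<inter> ECQ) LP \<inter> logic_interval ETL CL = {} \<and>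
         logic_interval ECQ (logic_join LP ECQ) \<inter> logic_interval ETL CL = {} \<and>
         (\<forall>L. is_extension BD L \<and> L \<noteq> BD \<and> L \<noteq> trivial_logic \<longrightarrow>
            L \<in> logic_interval (LP \<inter> ECQ) LP \<or>
            L \<in> logic_interval ECQ (logic_join LP ECQ) \<or>
            L \<in> logic_interval ETL CL)"
proof (intro conjI allI impI disjoint_logic_intervals)
  show "\<not> ECQ \<subseteq> LP" "\<not> ETL \<subseteq> logic_join LP ECQ" "\<not> ETL \<subseteq> LP"
    using ECQ_not_subset_LP ETL_not_subset_join_LP_ECQ LP_subset_join_LP_ECQ by blast+
next
  fix L assume L: "is_extension BD L \<and> L \<noteq> BD \<and> L \<noteq> trivial_logic"
  then interpret BD_extension L
    by unfold_locales (simp_all add: is_extension_def)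
  have "LP \<inter> ECQ \<subseteq> L"
    using L by (intro LP_Int_ECQ_subset explosion_excluded_middle_if_proper) simp
  moreover have "ECQ \<subseteq> L" if "\<not> L \<subseteq> LP"
    using that by (intro ECQ_subset explosion_if_not_subset_LP)
  moreover have "ETL \<subseteq> L" if "\<not> L \<subseteq> logic_join LP ECQ"
    using that by (intro ETL_subset disjunctive_syllogism_if_not_subset_join_LP_ECQ)
  moreover have "L \<subseteq> CL"
    using L derivable_if_not_subset_CL by (auto simp: trivial_logic_def)
  ultimately show "L \<in> logic_interval (LP \<inter> ECQ) LP \<or>
      L \<in> logic_interval ECQ (logic_join LP ECQ) \<or> L \<in> logic_interval ETL CL"
    using is_logic unfolding logic_interval_def by blast
qed

end
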